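(* Let $(E,\|\cdot\|)$ be a Banach space of real functions on $\mathbb{R}^d$ and let $(F,\|\cdot\|_* )$ be a Banach subspace of $E$ satisfying $\|u\|\le\|u\|_*$ for all $u\in F$. Let $|\cdot|_*:F\to\mathbb{R}$ be a function such that $|u|_*\le\|u\|_*$ and $|u+v|_*\le|u|_*+|v|_*$ for all $u,v\in F$, and $|\lambda u|_*=\lambda|u|_*$ for all $u\in F$, $\lambda\in\mathbb{R}_+$. Let $[0,T]$ be a time interval and let $\mathcal S_t$, $t\in[0,T]$, be a class of bounded and closed subsets of $F$, containing only non-negative functions, with $\mathcal S_t\subset\mathcal S_{t'}$ for $0\le t\le t'$, and such that $|u|_*=\|u\|_*$ for all $u\in\mathcal S_T$. Moreover, suppose that for any sequence $\{u_n\}$ in $\mathcal S_T$: if $u_n\ge0$, $\|u_n\|_*\le C$ for a constant $C$, and $\lim_{n\to\infty}\|u_n-u\|=0$, then $\lim_{n\to\infty}\|u_n-u\|_*=0$. Let $R_*>R^*>0$ and suppose $\mathcal Q:\mathcal S_T\to E$ is an operator for which there exist $R_0,C_*,C^*>0$ such that: ($\mathfrak A$) (Hölder continuity) there are a constant $C>0$ and $\beta\in(0,1)$ with $\|\mathcal Q[u]-\mathcal Q[v]\|\le C\|u-v\|^\beta$ for all $u,v\in\mathcal S_T$; ($\mathfrak B$) (sub-tangent condition) for each $u\in\mathcal S_T$ there exists $\xi_u>0$ such that for $0<\xi<\xi_u$ and for $\delta$ small enough there exists $z\in \big(B(u+\xi\mathcal Q[u],\delta)\cap\mathcal S_T\big)\setminus\{u+\xi\mathcal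 Q[u]\}$; moreover $$|z-u|_*\le\frac{C_*\xi}{2}\|u\|_*,\qquad \chi_{R_0}\frac{z-u}{\xi}\ge-\frac{C^*\chi_{R_0}}{2}u;$$ ($\mathfrak C$) (one-sided Lipschitz condition) there is a constant $C>0$ with $\big[\mathcal Q[u]-\mathcal Q[v],u-v\big]\le C\|u-v\|$ for all $u,v\in\mathcal S_T$, where $$[\varphi,\phi]:=\lim_{h\to0^-}h^{-1}\big(\|\phi+h\varphi\|-\|\phi\|\big).$$ Suppose moreover that $\mathcal S_T\cap B\big(O,\tfrac{R^*e^{-C^*T}}{2}\big)=\emptyset$ and $\mathcal S_T\subset B\big(O,(2R_*+1)e^{C_*T}\big)$. Then the equation $$\partial_tu=\mathcal Q[u]\ \text{ on }[0,T)\times E,\qquad u(0)=u_0\in\mathcal S_0\cap B_*(O,R_* )\setminus\overline{B_*(O,R^* )},$$ has a unique solution $u\in C^1((0,T),E)\cap C([0,T),\mathcal S_T)$.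
   Context: $B(x,r)$ denotes the ball centered at $x$ of radius $r$ with respect to $\|\cdot\|$, and $B_*(x,r)$ the ball with respect to $\|\cdot\|_*$; $O$ is the origin (zero element). $\chi_{R_0}$ is the characteristic function of the ball of radius $R_0$ centered at the origin of $\mathbb{R}^d$; the second inequality in ($\mathfrak B$) is between functions on $\mathbb{R}^d$. The letter $C$ denotes positive constants that may differ from condition to condition. *)

theory Defs
  imports "HOL-Analysis.Analysis"
begin

text \<open>
  A Banach space of real functions on $R^d$ is a Banach space \<open>'e\<close> together with the map \<open>val\<close>
  sending an element to the function it is. With \<open>M = count_space UNIV\<close>, "AE" means
  "everywhere", so \<open>val\<close> is an injective linear map and \<open>'e\<close> is literally a space of functions with
  pointwise operations. With \<open>M = lborel\<close>, functions are identified when they agree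
  Lebesgue-almost everywhere (as in $L^1$) and \<open>val\<close> picks a representative.
\<close>

definition function_space :: "(real ^ 'd) measure \<Rightarrow> ('e::real_vector \<Rightarrow> real ^ 'd \<Rightarrow> real) \<Rightarrow> bool" where
  "function_space M val \<longleftrightarrow>
     (M = count_space UNIV \<or> M = lborel) \<and>
     (\<forall>u v. AE x in M. val (u + v) x = val u x + val v x) \<and>
     (\<forall>c u. AE x in M. val (c *\<^sub>R u) x = c * val u x) \<and>
     (\<forall>u v. (AE x in M. val u x = val v x) \<longrightarrow> u = v)"

definition nonneg_fun :: "(real ^ 'd) measure \<Rightarrow> ('e \<Rightarrow> real ^ 'd \<Rightarrow> real) \<Rightarrow> 'e \<Rightarrow> bool" where
  "nonneg_fun M val u \<longleftrightarrow> (AE x in M. 0 \<le> val u x)"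

text \<open>
  \<open>nF\<close> is a function on the whole of \<open>'e\<close>, but only its values on \<open>F\<close> are meaningful. The metric is
  set to 0 off \<open>F\<close> because \<^locale>\<open>Metric_space\<close> demands nonnegativity and symmetry
  for all arguments, not just for points of the space.
\<close>

definition sub_dist :: "'e::real_vector set \<Rightarrow> ('e \<Rightarrow> real) \<Rightarrow> 'e \<Rightarrow> 'e \<Rightarrow> real" where
  "sub_dist F nF u v = (if u \<in> F \<and> v \<in> F then nF (u - v) else 0)"

definition banach_subspace :: "'e::real_vector set \<Rightarrow> ('e \<Rightarrow> real) \<Rightarrow> bool" where
  "banach_subspace F nF \<longleftrightarrow>
     subspace F \<and>
     (\<forall>u\<in>F. 0 \<le> nF u) \<and>
     (\<forall>u\<in>F. nF u = 0 \<longleftrightarrow> u = 0) \<and>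
     (\<forall>u\<in>F. \<forall>c. nF (c *\<^sub>R u) = \<bar>c\<bar> * nF u) \<and>
     (\<forall>u\<in>F. \<forall>v\<in>F. nF (u + v) \<le> nF u + nF v) \<and>
     Metric_space.mcomplete F (sub_dist F nF)"

abbreviation sub_topology :: "'e::real_vector set \<Rightarrow> ('e \<Rightarrow> real) \<Rightarrow> 'e topology" where
  "sub_topology F nF \<equiv> Metric_space.mtopology F (sub_dist F nF)"

abbreviation sub_ball :: "'e::real_vector set \<Rightarrow> ('e \<Rightarrow> real) \<Rightarrow> 'e \<Rightarrow> real \<Rightarrow> 'e set" where
  "sub_ball F nF \<equiv> Metric_space.mball F (sub_dist F nF)"

text \<open>The limit exists for all arguments, since \<open>\<lambda>h. norm (\<phi> + h *\<^sub>R \<psi>)\<close> is convex.\<close>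

definition bracket :: "'e::real_normed_vector \<Rightarrow> 'e \<Rightarrow> real" where
  "bracket \<psi> \<phi> = Lim (at_left 0) (\<lambda>h. (norm (\<phi> + h *\<^sub>R \<psi>) - norm \<phi>) / h)"

text \<open>
  Values of \<open>u\<close> outside $[0,T)$ are irrelevant. The derivative is taken in the norm of the large
  space and is one-sided at 0; continuity into \<open>S\<close> is with respect to the norm of \<open>F\<close>.
\<close>

definition evolution_solution ::
  "'e::real_normed_vector set \<Rightarrow> ('e \<Rightarrow> real) \<Rightarrow> 'e set \<Rightarrow> ('e \<Rightarrow> 'e) \<Rightarrow> real \<Rightarrow> 'e \<Rightarrow> (real \<Rightarrow> 'e) \<Rightarrow> bool" where
  "evolution_solution F nF S Q T u\<^sub>0 u \<longleftrightarrow>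
     u C1_differentiable_on {0<..<T} \<and>
     continuous_map (top_of_set {0..<T}) (subtopology (sub_topology F nF) S) u \<and>
     (\<forall>t\<in>{0..<T}. (u has_vector_derivative Q (u t)) (at t within {0..<T})) \<and>
     u 0 = u\<^sub>0"

end

theory Submission
  imports Defs
begin

text \<open>
  Write \<open>K\<close> for \<open>S T\<close>. A norm-convergent sequence in \<open>K\<close> also converges in \<open>nF\<close>, and \<open>K\<close> is closed in
  the \<open>nF\<close>-topology, so \<open>K\<close> is closed in the norm of the large space. The points \<open>z\<close> of the sub-tangent
  condition come arbitrarily close to \<open>u + \<xi> *\<^sub>R Q u\<close>, so this point itself belongs to \<open>K\<close>: from every
  point of \<open>K\<close>, a short segment in the direction of the field stays in \<open>K\<close>. The problem is thereby an
  ordinary differential equation for a bounded, uniformly continuous field on a closed set, and it is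
  solved in the norm of the large space by Euler polygons.

  The length of the admissible segments has no positive lower bound, so the steps of a
  polygon may accumulate before time \<open>T\<close>. A polygon with small defect \<open>\<epsilon>\<close> is therefore obtained from
  Zorn's lemma (\<open>euler_curve_exists\<close>): the defect is measured by the relation \<open>euler_step\<close> between
  pairs of points of the graph, which survives unions of chains, passage to a limit point, and the
  appending of one more segment.

  The one-sided Lipschitz condition makes the polygons converge. The bracket is the left derivative
  of the norm along a line, so the distance \<open>p\<close> of two curves with left defects \<open>\<kappa>\<close> and \<open>\<mu>\<close> satisfies
  \<open>p' \<le> A p + \<kappa> + \<mu>\<close> for the upper left Dini derivative, and a Gronwall argument bounds \<open>p\<close> by
  \<open>(\<kappa> + \<mu>) exp ((A + 1) t)\<close> (\<open>left_defect_comparison\<close>). With defects tending to 0 this gives the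
  existence of a limit, which solves the equation; with both defects equal to 0 it gives uniqueness.
  Finally, the convergence property of \<open>S T\<close> turns norm continuity of the solution into continuity
  with respect to \<open>nF\<close>.
\<close>

section \<open>The bracket as a left derivative of the norm\<close>

text \<open>
  Difference quotients of the convex function \<open>h \<mapsto> norm (x + h *\<^sub>R y)\<close> based at 0 are monotone.
\<close>

lemma norm_quotient_mono:
  fixes x y :: "'a::real_normed_vector"
  assumes "a \<le> b" "b < 0"
  shows "(norm (x + a *\<^sub>R y) - norm x) / a \<le> (norm (x + b *\<^sub>R y) - norm x) / b"
proof -
  define c where "c = b / a"
  have c: "0 < c" "c \<le> 1" using assms by (auto simp: c_def divide_simps)
  have b: "b = c * a" using assms by (simp add: c_def)
  \<comment> \<open>the nearer point lies on the segment from \<open>x\<close> to the farther one\<close>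
  have "x + b *\<^sub>R y = (1 - c) *\<^sub>R x + c *\<^sub>R (x + a *\<^sub>R y)"
    by (simp add: b algebra_simps)
  then have "norm (x + b *\<^sub>R y) \<le> norm ((1 - c) *\<^sub>R x) + norm (c *\<^sub>R (x + a *\<^sub>R y))"
    by (metis norm_triangle_ineq)
  also have "\<dots> = (1 - c) * norm x + c * norm (x + a *\<^sub>R y)" using c by simp
  finally have "norm (x + b *\<^sub>R y) - norm x \<le> c * (norm (x + a *\<^sub>R y) - norm x)"
    by (simp add: algebra_simps)
  then have "(norm (x + b *\<^sub>R y) - norm x) / b \<ge> c * (norm (x + a *\<^sub>R y) - norm x) / b"
    using assms by (simp add: divide_right_mono_neg)
  moreover have "c * (norm (x + a *\<^sub>R y) - norm x) / b = (norm (x + a *\<^sub>R y) - norm x) / a"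
    using assms c by (simp add: b)
  ultimately show ?thesis by simp
qed

text \<open>
  The bracket is defined through \<^const>\<open>Lim\<close>, which is meaningful only if the limit exists. The
  difference quotients increase as \<open>h\<close> increases to 0 and are bounded by \<open>norm y\<close>, so they converge.
\<close>

lemma bracket_tendsto:
  "((\<lambda>h. (norm (x + h *\<^sub>R y) - norm x) / h) \<longlongrightarrow> bracket y x) (at_left 0)"
proof -
  let ?f = "\<lambda>h. (norm (x + h *\<^sub>R y) - norm x) / h"
  have "?f h \<le> norm y" if "h < 0" for h
  proof -
    have "norm x \<le> norm (x + h *\<^sub>R y) + norm (h *\<^sub>R y)"
      by (metis add_diff_cancel_right' norm_triangle_ineq4)
    then show ?thesis using that by (simp add: divide_simps algebra_simps)
  qed
  then have "(?f \<longlongrightarrow> Sup (?f ` ({..<0} \<inter> UNIV))) (at 0 within ({..<0} \<inter> UNIV))"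
    by (intro Lim_left_bound norm_quotient_mono) auto
  then have *: "(?f \<longlongrightarrow> Sup (?f ` {..<0})) (at_left 0)" by simp
  then show ?thesis
    unfolding bracket_def using tendsto_Lim[OF _ *] by simp
qed

text \<open>
  A bound on the bracket controls how much the norm decreases in a short step backwards in time.
\<close>

lemma bracket_left_step:
  fixes x y :: "'a::real_normed_vector"
  assumes "bracket y x \<le> c" "0 < \<eta>"
  shows "\<forall>\<^sub>F h in at_right 0. norm x - norm (x - h *\<^sub>R y) \<le> h * (c + \<eta>)"
proof -
  have "\<forall>\<^sub>F h in at_left 0. (norm (x + h *\<^sub>R y) - norm x) / h < c + \<eta>"
    using assms by (intro order_tendstoD(2)[OF bracket_tendsto]) simp
  then have "\<forall>\<^sub>F h in at_right 0. (norm (x + (-h) *\<^sub>R y) - norm x) / (-h) < c + \<eta>"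
    by (simp add: at_left_minus eventually_filtermap)
  moreover have "\<forall>\<^sub>F h in at_right (0::real). 0 < h" by (simp add: eventually_at_right_less)
  ultimately show ?thesis
    by eventually_elim (simp add: field_simps)
qed

section \<open>Comparison of approximate solutions\<close>

text \<open>
  A Gronwall inequality for the upper left Dini derivative. For \<open>\<kappa>' > \<kappa>\<close> the function
  \<open>q t = \<kappa>' exp ((A + 1) t)\<close> starts above \<open>p\<close> and satisfies \<open>q' = A q + q \<ge> A q + \<kappa>'\<close>, so at a first
  time where \<open>p\<close> meets \<open>q\<close> it would have to grow faster than the hypothesis allows. The rate \<open>A + 1\<close>
  instead of \<open>A\<close> makes this strict without a separate treatment of \<open>A = 0\<close>.
\<close>

lemma left_gronwall:
  fixes p :: "real \<Rightarrow> real"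
  assumes cont: "continuous_on {0..b} p" and p0: "p 0 \<le> \<kappa>" and "0 \<le> \<kappa>" and A: "0 \<le> A"
    and step: "\<And>t \<eta>. 0 < t \<Longrightarrow> t \<le> b \<Longrightarrow> 0 < \<eta> \<Longrightarrow>
      \<forall>\<^sub>F h in at_right 0. p t - p (t - h) \<le> h * (A * p t + \<kappa> + \<eta>)"
    and t: "t \<in> {0..b}"
  shows "p t \<le> \<kappa> * exp ((A + 1) * t)"
proof -
  have "p t \<le> \<kappa>' * exp ((A + 1) * t)" if \<kappa>': "\<kappa> < \<kappa>'" for \<kappa>'
  proof (rule ccontr)
    define q where "q s = \<kappa>' * exp ((A + 1) * s)" for s
    assume "\<not> p t \<le> \<kappa>' * exp ((A + 1) * t)"
    then have pq: "p t > q t" by (simp add: q_def)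
    have contq: "continuous_on {0..b} (\<lambda>s. p s - q s)"
      unfolding q_def by (intro continuous_intros cont)
    define Z where "Z = {s \<in> {0..b}. 0 \<le> p s - q s}"
    have "Z = {0..b} \<inter> (\<lambda>s. p s - q s) -` {0..}" by (auto simp: Z_def)
    then have "closed Z"
      using continuous_closed_preimage[OF contq closed_atLeastAtMost closed_atLeast] by metis
    moreover have "bounded Z" unfolding Z_def
      by (rule bounded_subset[of "{0..b}"]) auto
    moreover have "t \<in> Z" using t pq by (simp add: Z_def)
    ultimately obtain \<tau> where \<tau>: "\<tau> \<in> Z" and min: "\<And>s. s \<in> Z \<Longrightarrow> \<tau> \<le> s"
      using compact_attains_inf[of Z] compact_eq_bounded_closed by (metis empty_iff)
    have "\<tau> \<noteq> 0" using \<tau> p0 \<kappa>' by (auto simp: Z_def q_def)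
    then have \<tau>0: "0 < \<tau>" "\<tau> \<le> b" using \<tau> by (auto simp: Z_def)
    have before: "p s < q s" if "0 \<le> s" "s < \<tau>" for s
      using min[of s] that \<tau>0 by (force simp: Z_def)
    \<comment> \<open>so \<open>\<tau>\<close> is the first meeting time, and equality holds there by left continuity\<close>
    have "p \<tau> - q \<tau> \<le> 0"
    proof (rule tendsto_upperbound)
      have "((\<lambda>s. p s - q s) \<longlongrightarrow> p \<tau> - q \<tau>) (at \<tau> within {0..b})"
        using contq \<tau>0 by (auto simp: continuous_on_def)
      then show "((\<lambda>s. p s - q s) \<longlongrightarrow> p \<tau> - q \<tau>) (at \<tau> within {0..<\<tau>})"
        by (rule tendsto_within_subset) (use \<tau>0 in auto)
      show "\<forall>\<^sub>F s in at \<tau> within {0..<\<tau>}. p s - q s \<le> 0"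
        using before by (auto simp: eventually_at_filter less_eq_real_def)
      show "at \<tau> within {0..<\<tau>} \<noteq> bot"
        using \<tau>0 by (simp add: at_within_eq_bot_iff)
    qed
    then have eq: "p \<tau> = q \<tau>" using \<tau> by (simp add: Z_def)
    define \<eta> where "\<eta> = (\<kappa>' - \<kappa>) / 2"
    have \<eta>: "0 < \<eta>" using \<kappa>' by (simp add: \<eta>_def)
    have "(q has_real_derivative (A + 1) * q \<tau>) (at \<tau>)"
      unfolding q_def by (auto intro!: derivative_eq_intros)
    then have "((\<lambda>h. (q (\<tau> + h) - q \<tau>) / h) \<longlongrightarrow> (A + 1) * q \<tau>) (at_left 0)"
      by (auto simp: DERIV_def intro: tendsto_within_subset)
    then have "((\<lambda>h. (q (\<tau> + (- h)) - q \<tau>) / (- h)) \<longlongrightarrow> (A + 1) * q \<tau>) (at_right 0)"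
      by (simp add: at_left_minus filterlim_filtermap)
    moreover have "A * q \<tau> + \<kappa> + \<eta> < (A + 1) * q \<tau>"
    proof -
      have "\<kappa>' * 1 \<le> q \<tau>" unfolding q_def
        by (rule mult_left_mono) (use A \<tau>0 \<kappa>' \<open>0 \<le> \<kappa>\<close> in auto)
      then show ?thesis using \<kappa>' by (simp add: \<eta>_def algebra_simps field_simps)
    qed
    ultimately have "\<forall>\<^sub>F h in at_right 0. A * q \<tau> + \<kappa> + \<eta> < (q (\<tau> + (- h)) - q \<tau>) / (- h)"
      by (rule order_tendstoD)
    moreover have "\<forall>\<^sub>F h in at_right 0. h < \<tau>"
      using \<tau>0 eventually_at_right_real[of 0 \<tau>] by (auto elim: eventually_mono)
    moreover have "\<forall>\<^sub>F h in at_right (0::real). 0 < h" by (simp add: eventually_at_right_less)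
    moreover note step[OF \<tau>0 \<eta>]
    ultimately have "\<forall>\<^sub>F h in at_right (0::real). False"
    proof eventually_elim
      case (elim h)
      have "p (\<tau> - h) < q (\<tau> - h)" using elim before by simp
      moreover have "h * (A * q \<tau> + \<kappa> + \<eta>) < q \<tau> - q (\<tau> - h)"
        using elim by (simp add: field_simps)
      ultimately show False using elim eq by simp
    qed
    then show False by simp
  qed
  then have "p t / exp ((A + 1) * t) \<le> \<kappa>'" if "\<kappa> < \<kappa>'" for \<kappa>'
    using that by (simp add: divide_simps mult.commute)
  then have "p t / exp ((A + 1) * t) \<le> \<kappa>" by (rule dense_ge)
  then show ?thesis by (simp add: divide_simps mult.commute)
qed

text \<open>
  The condition looks backwards in time because the bracket is a left derivative. An estimate of
  the form \<open>\<kappa> + \<eta>\<close> with arbitrary \<open>\<eta> > 0\<close> includes exact solutions as the case \<open>\<kappa> = 0\<close>.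
\<close>

definition left_defect :: "('e::real_normed_vector \<Rightarrow> 'e) \<Rightarrow> real \<Rightarrow> (real \<Rightarrow> 'e) \<Rightarrow> real \<Rightarrow> bool" where
  "left_defect Q \<kappa> x t \<longleftrightarrow> (\<forall>\<eta>>0. \<forall>\<^sub>F h in at_right 0.
     norm (x t - x (t - h) - h *\<^sub>R Q (x t)) \<le> h * (\<kappa> + \<eta>))"

text \<open>
  Up to the two defects, the difference of the curves one step \<open>h\<close> earlier is
  \<open>(x t - y t) - h *\<^sub>R (Q (x t) - Q (y t))\<close>. The bracket condition says that its norm is not much smaller
  than that of \<open>x t - y t\<close>, which is the hypothesis of \<open>left_gronwall\<close> for the distance.
\<close>

lemma left_defect_comparison:
  fixes x y :: "real \<Rightarrow> 'e::real_normed_vector"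
  assumes osl: "\<And>u v. u \<in> K \<Longrightarrow> v \<in> K \<Longrightarrow> bracket (Q u - Q v) (u - v) \<le> A * norm (u - v)"
    and "0 \<le> A" "0 \<le> \<kappa>" "0 \<le> \<mu>"
    and x: "continuous_on {0..b} x" "\<And>t. t \<in> {0..b} \<Longrightarrow> x t \<in> K"
      "\<And>t. 0 < t \<Longrightarrow> t \<le> b \<Longrightarrow> left_defect Q \<kappa> x t"
    and y: "continuous_on {0..b} y" "\<And>t. t \<in> {0..b} \<Longrightarrow> y t \<in> K"
      "\<And>t. 0 < t \<Longrightarrow> t \<le> b \<Longrightarrow> left_defect Q \<mu> y t"
    and "x 0 = y 0" and t: "t \<in> {0..b}"
  shows "norm (x t - y t) \<le> (\<kappa> + \<mu>) * exp ((A + 1) * t)"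
proof (rule left_gronwall[of b "\<lambda>t. norm (x t - y t)"])
  show "continuous_on {0..b} (\<lambda>t. norm (x t - y t))" by (intro continuous_intros x y)
  fix t \<eta> :: real assume t: "0 < t" "t \<le> b" and \<eta>: "0 < \<eta>"
  define \<phi> where "\<phi> = x t - y t"
  define \<psi> where "\<psi> = Q (x t) - Q (y t)"
  have "\<forall>\<^sub>F h in at_right 0. norm \<phi> - norm (\<phi> - h *\<^sub>R \<psi>) \<le> h * (A * norm \<phi> + \<eta> / 3)"
    unfolding \<phi>_def \<psi>_def using t x y \<eta> by (intro bracket_left_step osl) auto
  moreover have "\<forall>\<^sub>F h in at_right 0. norm (x t - x (t - h) - h *\<^sub>R Q (x t)) \<le> h * (\<kappa> + \<eta> / 3)"
    using x(3)[OF t] \<eta> by (simp add: left_defect_def)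
  moreover have "\<forall>\<^sub>F h in at_right 0. norm (y t - y (t - h) - h *\<^sub>R Q (y t)) \<le> h * (\<mu> + \<eta> / 3)"
    using y(3)[OF t] \<eta> by (simp add: left_defect_def)
  ultimately show "\<forall>\<^sub>F h in at_right 0. norm (x t - y t) - norm (x (t - h) - y (t - h))
      \<le> h * (A * norm (x t - y t) + (\<kappa> + \<mu>) + \<eta>)"
  proof eventually_elim
    case (elim h)
    define d where "d = x t - x (t - h) - h *\<^sub>R Q (x t)"
    define e where "e = y t - y (t - h) - h *\<^sub>R Q (y t)"
    have "\<phi> - h *\<^sub>R \<psi> = (x (t - h) - y (t - h)) + (d - e)"
      by (simp add: \<phi>_def \<psi>_def d_def e_def algebra_simps)
    then have "norm (\<phi> - h *\<^sub>R \<psi>) \<le> norm (x (t - h) - y (t - h)) + norm (d - e)"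
      by (metis norm_triangle_ineq)
    also have "norm (d - e) \<le> norm d + norm e" by (rule norm_triangle_ineq4)
    finally have "norm \<phi> - norm (x (t - h) - y (t - h))
        \<le> h * (A * norm \<phi> + \<eta> / 3) + h * (\<kappa> + \<eta> / 3) + h * (\<mu> + \<eta> / 3)"
      using elim unfolding d_def e_def by linarith
    then show ?case by (simp add: \<phi>_def algebra_simps)
  qed
qed (use \<open>0 \<le> A\<close> \<open>0 \<le> \<kappa>\<close> \<open>0 \<le> \<mu>\<close> \<open>x 0 = y 0\<close> t in simp_all)

lemma left_defect_derivative:
  assumes "(x has_vector_derivative Q (x t)) (at t within {0..t})" "0 < t"
  shows "left_defect Q 0 x t"
  unfolding left_defect_def
proof (intro allI impI)
  fix \<eta> :: real assume "0 < \<eta>"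
  have "\<forall>e>0. \<exists>d>0. \<forall>s\<in>{0..t}. norm (s - t) < d \<longrightarrow>
      norm (x s - x t - (s - t) *\<^sub>R Q (x t)) \<le> e * norm (s - t)"
    using assms(1) unfolding has_vector_derivative_def has_derivative_within_alt by blast
  then obtain d where d: "0 < d" "\<And>s. s \<in> {0..t} \<Longrightarrow> \<bar>s - t\<bar> < d \<Longrightarrow>
      norm (x s - x t - (s - t) *\<^sub>R Q (x t)) \<le> \<eta> * \<bar>s - t\<bar>"
    using \<open>0 < \<eta>\<close> unfolding real_norm_def by meson
  have "norm (x t - x (t - h) - h *\<^sub>R Q (x t)) \<le> h * (0 + \<eta>)" if "0 < h" "h < min d t" for h
  proof -
    have "x t - x (t - h) - h *\<^sub>R Q (x t) = - (x (t - h) - x t - (t - h - t) *\<^sub>R Q (x t))" by simp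
    then have "norm (x t - x (t - h) - h *\<^sub>R Q (x t)) = norm (x (t - h) - x t - (t - h - t) *\<^sub>R Q (x t))"
      by (metis norm_minus_cancel)
    then show ?thesis using d(2)[of "t - h"] that by (simp add: mult.commute)
  qed
  then show "\<forall>\<^sub>F h in at_right 0. norm (x t - x (t - h) - h *\<^sub>R Q (x t)) \<le> h * (0 + \<eta>)"
    using d(1) assms(2) by (auto simp: eventually_at_right_field intro!: exI[of _ "min d t"])
qed

lemma solution_unique:
  assumes osl: "\<And>u v. u \<in> K \<Longrightarrow> v \<in> K \<Longrightarrow> bracket (Q u - Q v) (u - v) \<le> A * norm (u - v)"
    and "0 \<le> A"
    and x: "\<And>t. t \<in> {0..b} \<Longrightarrow> x t \<in> K \<and> (x has_vector_derivative Q (x t)) (at t within {0..b})"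
    and y: "\<And>t. t \<in> {0..b} \<Longrightarrow> y t \<in> K \<and> (y has_vector_derivative Q (y t)) (at t within {0..b})"
    and "x 0 = y 0" and t: "t \<in> {0..b}"
  shows "x t = y t"
proof -
  have c: "continuous_on {0..b} z"
    if "\<forall>t\<in>{0..b}. z t \<in> K \<and> (z has_vector_derivative Q (z t)) (at t within {0..b})" for z
    using that has_vector_derivative_continuous continuous_on_eq_continuous_within by blast
  have d: "left_defect Q 0 z t"
    if "\<forall>t\<in>{0..b}. z t \<in> K \<and> (z has_vector_derivative Q (z t)) (at t within {0..b})"
      and t: "0 < t" "t \<le> b" for z t
  proof (rule left_defect_derivative)
    have "(z has_vector_derivative Q (z t)) (at t within {0..b})" using that by auto
    then show "(z has_vector_derivative Q (z t)) (at t within {0..t})"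
      by (rule has_vector_derivative_within_subset) (use t in auto)
  qed (rule t)
  have "norm (x t - y t) \<le> (0 + 0) * exp ((A + 1) * t)"
  proof (rule left_defect_comparison[where K = K and Q = Q and b = b])
    show "continuous_on {0..b} x" "continuous_on {0..b} y" using c x y by blast+
    show "left_defect Q 0 x s" "left_defect Q 0 y s" if "0 < s" "s \<le> b" for s
      using d x y that by blast+
    show "x s \<in> K" "y s \<in> K" if "s \<in> {0..b}" for s using x y that by blast+
  qed (use \<open>0 \<le> A\<close> \<open>x 0 = y 0\<close> t in \<open>simp_all add: osl\<close>)
  then show ?thesis by simp
qed

section \<open>Euler curves in a closed set\<close>

text \<open>
  Uniform continuity is encoded by the monotone modulus \<open>\<omega>\<close> so that the defects below can be written as
  explicit functions of the elapsed time. The bound \<open>L\<close> is required to be positive so that one can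
  divide by it.
\<close>

locale inward_field =
  fixes K :: "'e::banach set" and Q :: "'e \<Rightarrow> 'e" and L :: real and \<omega> :: "real \<Rightarrow> real"
  assumes closed: "closed K"
    and inward: "\<And>x. x \<in> K \<Longrightarrow> \<exists>\<xi>>0. \<forall>h. 0 < h \<and> h < \<xi> \<longrightarrow> x + h *\<^sub>R Q x \<in> K"
    and speed: "\<And>x. x \<in> K \<Longrightarrow> norm (Q x) \<le> L"
    and L_pos: "0 < L"
    and modulus: "\<And>x y. x \<in> K \<Longrightarrow> y \<in> K \<Longrightarrow> norm (Q x - Q y) \<le> \<omega> (norm (x - y))"
    and modulus_mono: "\<And>r s. 0 \<le> r \<Longrightarrow> r \<le> s \<Longrightarrow> \<omega> r \<le> \<omega> s"
    and modulus_vanishes: "\<And>e. 0 < e \<Longrightarrow> \<exists>d>0. \<omega> d \<le> e"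
begin

lemma modulus_le:
  "x \<in> K \<Longrightarrow> y \<in> K \<Longrightarrow> norm (x - y) \<le> r \<Longrightarrow> norm (Q x - Q y) \<le> \<omega> r"
  by (meson modulus modulus_mono norm_ge_zero order_trans)

lemma modulus_small_time:
  assumes "0 < e" shows "\<exists>d>0. \<forall>h. 0 \<le> h \<and> h \<le> d \<longrightarrow> \<omega> (L * h) \<le> e"
proof -
  obtain d where d: "d > 0" "\<omega> d \<le> e" using modulus_vanishes assms by blast
  show ?thesis
  proof (intro exI[of _ "d / L"] conjI allI impI)
    show "0 < d / L" using d L_pos by simp
    fix h assume "0 \<le> h \<and> h \<le> d / L"
    then have "0 \<le> L * h" "L * h \<le> d" using L_pos by (auto simp: field_simps)
    then show "\<omega> (L * h) \<le> e" using modulus_mono d by fastforce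
  qed
qed

lemma continuous_on_field: "continuous_on K Q"
  unfolding continuous_on_iff
proof (intro ballI allI impI)
  fix x and e :: real assume "x \<in> K" "0 < e"
  obtain d where d: "d > 0" "\<omega> d \<le> e / 2" using modulus_vanishes[of "e/2"] \<open>0 < e\<close> by auto
  have "dist (Q y) (Q x) < e" if "y \<in> K" "dist y x < d" for y
    using modulus_le[of y x d] that \<open>x \<in> K\<close> d \<open>0 < e\<close> by (simp add: dist_norm)
  then show "\<exists>d>0. \<forall>y\<in>K. dist y x < d \<longrightarrow> dist (Q y) (Q x) < e"
    using d by blast
qed

text \<open>
  The point \<open>y\<close> at time \<open>t\<close> is reachable from \<open>x\<close> at time \<open>s\<close> with speed at most \<open>L\<close> and mean velocity
  close to \<open>Q x\<close>. The term \<open>\<omega> (L * (t - s))\<close> is the change of the field that speed \<open>L\<close> permits in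
  time \<open>t - s\<close>; allowing it makes the relation hold between any two points of a polygon, at any distance
  in time, so that no step size enters. An exact solution has \<open>\<epsilon> = 0\<close>.
\<close>

definition euler_step :: "real \<Rightarrow> real \<Rightarrow> 'e \<Rightarrow> real \<Rightarrow> 'e \<Rightarrow> bool" where
  "euler_step \<epsilon> s x t y \<longleftrightarrow> norm (y - x) \<le> L * (t - s) \<and>
     norm (y - x - (t - s) *\<^sub>R Q x) \<le> (t - s) * (\<epsilon> + \<omega> (L * (t - s)))"

text \<open>
  Appending a segment with velocity \<open>Q y\<close> costs \<open>norm (Q y - Q x)\<close> per unit of time, which is at most
  \<open>\<omega> (L * (a - s))\<close> because \<open>y\<close> is within \<open>L * (a - s)\<close> of \<open>x\<close>.
\<close>

lemma euler_step_prolong: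
  assumes "euler_step \<epsilon> s x a y" "x \<in> K" "y \<in> K" "s \<le> a" "0 \<le> \<tau>" "0 \<le> \<epsilon>"
  shows "euler_step \<epsilon> s x (a + \<tau>) (y + \<tau> *\<^sub>R Q y)"
  unfolding euler_step_def
proof
  have yx: "norm (y - x) \<le> L * (a - s)"
    and e: "norm (y - x - (a - s) *\<^sub>R Q x) \<le> (a - s) * (\<epsilon> + \<omega> (L * (a - s)))"
    using assms by (auto simp: euler_step_def)
  have "norm (y + \<tau> *\<^sub>R Q y - x) \<le> norm (y - x) + \<tau> * norm (Q y)"
    using norm_triangle_ineq[of "y - x" "\<tau> *\<^sub>R Q y"] assms by (simp add: algebra_simps)
  also have "\<dots> \<le> L * (a - s) + \<tau> * L"
    using yx speed assms by (intro add_mono mult_left_mono) auto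
  finally show "norm (y + \<tau> *\<^sub>R Q y - x) \<le> L * (a + \<tau> - s)" by (simp add: algebra_simps)
  have m: "\<omega> (L * (a - s)) \<le> \<omega> (L * (a + \<tau> - s))"
    using assms L_pos by (intro modulus_mono) auto
  have "y + \<tau> *\<^sub>R Q y - x - (a + \<tau> - s) *\<^sub>R Q x = (y - x - (a - s) *\<^sub>R Q x) + \<tau> *\<^sub>R (Q y - Q x)"
    by (simp add: algebra_simps)
  then have "norm (y + \<tau> *\<^sub>R Q y - x - (a + \<tau> - s) *\<^sub>R Q x)
      \<le> norm (y - x - (a - s) *\<^sub>R Q x) + norm (\<tau> *\<^sub>R (Q y - Q x))"
    using norm_triangle_ineq[of "y - x - (a - s) *\<^sub>R Q x" "\<tau> *\<^sub>R (Q y - Q x)"] by metis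
  also have "\<dots> = norm (y - x - (a - s) *\<^sub>R Q x) + \<tau> * norm (Q y - Q x)"
    using assms by simp
  also have "\<dots> \<le> (a - s) * (\<epsilon> + \<omega> (L * (a - s))) + \<tau> * \<omega> (L * (a - s))"
    using e modulus_le[OF \<open>y \<in> K\<close> \<open>x \<in> K\<close> yx] assms by (intro add_mono mult_left_mono) auto
  also have "\<dots> \<le> (a - s) * (\<epsilon> + \<omega> (L * (a + \<tau> - s))) + \<tau> * (\<epsilon> + \<omega> (L * (a + \<tau> - s)))"
    using m assms by (intro add_mono mult_left_mono) auto
  finally show "norm (y + \<tau> *\<^sub>R Q y - x - (a + \<tau> - s) *\<^sub>R Q x)
      \<le> (a + \<tau> - s) * (\<epsilon> + \<omega> (L * (a + \<tau> - s)))" by (simp add: algebra_simps)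
qed

text \<open>
  Along one segment the velocity is \<open>Q\<close> at its starting point rather than at the current point. This is
  where \<open>\<epsilon>\<close> is needed, and it dictates how long the segment may be.
\<close>

lemma euler_step_segment:
  assumes y: "y \<in> K" "y + \<sigma> *\<^sub>R Q y \<in> K" and "0 \<le> \<sigma>" "\<sigma> \<le> \<tau>" "\<omega> (L * \<sigma>) \<le> \<epsilon>"
  shows "euler_step \<epsilon> (a + \<sigma>) (y + \<sigma> *\<^sub>R Q y) (a + \<tau>) (y + \<tau> *\<^sub>R Q y)"
  unfolding euler_step_def
proof
  have d: "y + \<tau> *\<^sub>R Q y - (y + \<sigma> *\<^sub>R Q y) = (\<tau> - \<sigma>) *\<^sub>R Q y" by (simp add: algebra_simps)
  show "norm (y + \<tau> *\<^sub>R Q y - (y + \<sigma> *\<^sub>R Q y)) \<le> L * (a + \<tau> - (a + \<sigma>))"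
    unfolding d using mult_left_mono[OF speed[OF y(1)], of "\<tau> - \<sigma>"] assms(4)
    by (simp add: mult.commute)
  have "norm (\<sigma> *\<^sub>R Q y) \<le> L * \<sigma>"
    using mult_left_mono[OF speed[OF y(1)], of \<sigma>] assms(3) by (simp add: mult.commute)
  then have "norm (Q y - Q (y + \<sigma> *\<^sub>R Q y)) \<le> \<omega> (L * \<sigma>)"
    using modulus_le[OF y] by simp
  moreover have "0 \<le> \<omega> (L * (\<tau> - \<sigma>))"
    using modulus_mono[of 0 "L * (\<tau> - \<sigma>)"] modulus[OF y(1) y(1)] L_pos assms(4) by simp
  ultimately have "norm (Q y - Q (y + \<sigma> *\<^sub>R Q y)) \<le> \<epsilon> + \<omega> (L * (\<tau> - \<sigma>))"
    using assms(5) by linarith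
  then have "(\<tau> - \<sigma>) * norm (Q y - Q (y + \<sigma> *\<^sub>R Q y)) \<le> (\<tau> - \<sigma>) * (\<epsilon> + \<omega> (L * (\<tau> - \<sigma>)))"
    using assms(4) by (intro mult_left_mono) auto
  moreover have "y + \<tau> *\<^sub>R Q y - (y + \<sigma> *\<^sub>R Q y) - (a + \<tau> - (a + \<sigma>)) *\<^sub>R Q (y + \<sigma> *\<^sub>R Q y)
      = (\<tau> - \<sigma>) *\<^sub>R (Q y - Q (y + \<sigma> *\<^sub>R Q y))"
    unfolding d by (simp add: algebra_simps)
  ultimately show "norm (y + \<tau> *\<^sub>R Q y - (y + \<sigma> *\<^sub>R Q y) - (a + \<tau> - (a + \<sigma>)) *\<^sub>R Q (y + \<sigma> *\<^sub>R Q y))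
      \<le> (a + \<tau> - (a + \<sigma>)) * (\<epsilon> + \<omega> (L * (a + \<tau> - (a + \<sigma>))))"
    using assms(4) by (simp only: norm_scaleR) simp
qed

lemma euler_step_limit:
  assumes X: "\<And>n::nat. euler_step \<epsilon> s x (\<tau> n) (X n)"
    and \<tau>: "\<tau> \<longlonglongrightarrow> a" "\<And>n. s \<le> \<tau> n" "\<And>n. \<tau> n \<le> a" and Xy: "X \<longlonglongrightarrow> y"
  shows "euler_step \<epsilon> s x a y"
  unfolding euler_step_def
proof
  show "norm (y - x) \<le> L * (a - s)"
  proof (rule LIMSEQ_le)
    show "(\<lambda>n. norm (X n - x)) \<longlonglongrightarrow> norm (y - x)" by (intro tendsto_intros Xy)
    show "(\<lambda>n. L * (\<tau> n - s)) \<longlonglongrightarrow> L * (a - s)" by (intro tendsto_intros \<tau>)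
  qed (use X in \<open>auto simp: euler_step_def\<close>)
  show "norm (y - x - (a - s) *\<^sub>R Q x) \<le> (a - s) * (\<epsilon> + \<omega> (L * (a - s)))"
  proof (rule LIMSEQ_le)
    show "(\<lambda>n. norm (X n - x - (\<tau> n - s) *\<^sub>R Q x)) \<longlonglongrightarrow> norm (y - x - (a - s) *\<^sub>R Q x)"
      by (intro tendsto_intros Xy \<tau>)
    show "(\<lambda>n. (\<tau> n - s) * (\<epsilon> + \<omega> (L * (a - s)))) \<longlonglongrightarrow> (a - s) * (\<epsilon> + \<omega> (L * (a - s)))"
      by (intro tendsto_intros \<tau>)
    have "norm (X n - x - (\<tau> n - s) *\<^sub>R Q x) \<le> (\<tau> n - s) * (\<epsilon> + \<omega> (L * (a - s)))" for n
    proof -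
      have "(\<tau> n - s) * (\<epsilon> + \<omega> (L * (\<tau> n - s))) \<le> (\<tau> n - s) * (\<epsilon> + \<omega> (L * (a - s)))"
        using \<tau>(2,3)[of n] L_pos by (intro mult_left_mono add_left_mono modulus_mono) auto
      then show ?thesis using X[of n] by (simp add: euler_step_def)
    qed
    then show "\<exists>N. \<forall>n\<ge>N. norm (X n - x - (\<tau> n - s) *\<^sub>R Q x) \<le> (\<tau> n - s) * (\<epsilon> + \<omega> (L * (a - s)))"
      by blast
  qed
qed

text \<open>
  Partial curves are represented by their graphs, so that extension is inclusion. The graph is
  single-valued because \<open>euler_step \<epsilon> t x t y\<close> forces \<open>x = y\<close>. The last condition says that the
  domain is an initial interval; without it a maximal graph could have gaps.
\<close>

definition euler_graph :: "real \<Rightarrow> real \<Rightarrow> 'e \<Rightarrow> (real \<times> 'e) set \<Rightarrow> bool" where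
  "euler_graph \<epsilon> T x\<^sub>0 G \<longleftrightarrow> G \<subseteq> {0..T} \<times> K \<and> (0, x\<^sub>0) \<in> G \<and>
     (\<forall>s x t y. (s, x) \<in> G \<longrightarrow> (t, y) \<in> G \<longrightarrow> s \<le> t \<longrightarrow> euler_step \<epsilon> s x t y) \<and>
     (\<forall>s t y. (t, y) \<in> G \<longrightarrow> 0 \<le> s \<longrightarrow> s \<le> t \<longrightarrow> (\<exists>x. (s, x) \<in> G))"

text \<open>
  Every condition on the graph concerns at most two of its points, so it passes to the union of a chain.
\<close>

lemma euler_graph_maximal:
  assumes "x\<^sub>0 \<in> K" "0 \<le> T"
  shows "\<exists>G. euler_graph \<epsilon> T x\<^sub>0 G \<and> (\<forall>H. euler_graph \<epsilon> T x\<^sub>0 H \<longrightarrow> G \<subseteq> H \<longrightarrow> H = G)"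
proof -
  have "\<exists>G\<in>Collect (euler_graph \<epsilon> T x\<^sub>0). \<forall>H\<in>Collect (euler_graph \<epsilon> T x\<^sub>0). G \<subseteq> H \<longrightarrow> H = G"
  proof (rule subset_Zorn_nonempty)
    have "euler_graph \<epsilon> T x\<^sub>0 {(0, x\<^sub>0)}"
      using assms by (auto simp: euler_graph_def euler_step_def)
    then show "Collect (euler_graph \<epsilon> T x\<^sub>0) \<noteq> {}" by blast
    fix \<C> assume ne: "\<C> \<noteq> {}" and "subset.chain (Collect (euler_graph \<epsilon> T x\<^sub>0)) \<C>"
    then have g: "\<And>G. G \<in> \<C> \<Longrightarrow> euler_graph \<epsilon> T x\<^sub>0 G"
      and ch: "\<And>G H. G \<in> \<C> \<Longrightarrow> H \<in> \<C> \<Longrightarrow> G \<subseteq> H \<or> H \<subseteq> G"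
      by (auto simp: subset_chain_def)
    have "euler_step \<epsilon> s x t y" if sx: "(s, x) \<in> \<Union>\<C>" and ty: "(t, y) \<in> \<Union>\<C>" and st: "s \<le> t" for s x t y
    proof -
      obtain G where "G \<in> \<C>" "(s, x) \<in> G" "(t, y) \<in> G" using sx ty ch by blast
      then show ?thesis using g st unfolding euler_graph_def by blast
    qed
    moreover have "\<Union>\<C> \<subseteq> {0..T} \<times> K" "(0, x\<^sub>0) \<in> \<Union>\<C>"
      using g ne unfolding euler_graph_def by blast+
    moreover have "\<exists>x. (s, x) \<in> \<Union>\<C>" if "(t, y) \<in> \<Union>\<C>" "0 \<le> s" "s \<le> t" for s t y
      using g that unfolding euler_graph_def by blast
    ultimately show "\<Union>\<C> \<in> Collect (euler_graph \<epsilon> T x\<^sub>0)"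
      unfolding euler_graph_def by blast
  qed
  then show ?thesis by blast
qed

text \<open>
  Let \<open>a\<close> be the supremum of the domain of a maximal graph. The curve is Lipschitz, hence has a limit at
  \<open>a\<close>, and by maximality this limit point belongs to the graph. If \<open>a < T\<close>, a short segment in the
  direction of the field could be appended, contradicting maximality.
\<close>

lemma euler_curve_exists:
  assumes "x\<^sub>0 \<in> K" "0 \<le> T" "0 < \<epsilon>"
  shows "\<exists>w. w 0 = x\<^sub>0 \<and> (\<forall>t\<in>{0..T}. w t \<in> K) \<and>
    (\<forall>s t. 0 \<le> s \<longrightarrow> s \<le> t \<longrightarrow> t \<le> T \<longrightarrow> euler_step \<epsilon> s (w s) t (w t))"
proof -
  obtain G where G: "euler_graph \<epsilon> T x\<^sub>0 G"
    and max: "\<And>H. euler_graph \<epsilon> T x\<^sub>0 H \<Longrightarrow> G \<subseteq> H \<Longrightarrow> H = G"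
    using euler_graph_maximal[OF assms(1,2)] by blast
  have inG: "0 \<le> t" "t \<le> T" "y \<in> K" if "(t, y) \<in> G" for t y
    using G that unfolding euler_graph_def by auto
  have start: "(0, x\<^sub>0) \<in> G" using G unfolding euler_graph_def by blast
  have step: "euler_step \<epsilon> s x t y" if "(s, x) \<in> G" "(t, y) \<in> G" "s \<le> t" for s x t y
    using G that unfolding euler_graph_def by blast
  have down: "\<exists>x. (s, x) \<in> G" if "(t, y) \<in> G" "0 \<le> s" "s \<le> t" for s t y
    using G that unfolding euler_graph_def by blast
  define D where "D = fst ` G"
  define a where "a = Sup D"
  have D: "bdd_above D" "D \<noteq> {}"
    using inG start by (auto simp: D_def bdd_above_def intro!: exI[of _ T])
  have le_a: "t \<le> a" if "(t, y) \<in> G" for t y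
    unfolding a_def using that by (intro cSup_upper D) (auto simp: D_def image_iff intro!: bexI)
  have a: "0 \<le> a" "a \<le> T"
    using le_a[OF start] cSup_least[OF D(2), of T] inG(2) by (force simp: a_def D_def)+
  have below: "\<exists>x. (s, x) \<in> G" if s: "0 \<le> s" "s < a" for s
  proof -
    obtain t where "t \<in> D" "s < t" using s less_cSup_iff[OF D(2,1)] by (auto simp: a_def)
    then show ?thesis using down s by (force simp: D_def)
  qed
  have "\<exists>y. (a, y) \<in> G"
  proof (rule ccontr)
    assume no: "\<nexists>y. (a, y) \<in> G"
    then have "0 < a" using a start by (cases "a = 0") auto
    define \<tau> where "\<tau> n = a - a / real (Suc n)" for n
    have \<tau>: "0 \<le> \<tau> n" "\<tau> n < a" for n
      using \<open>0 < a\<close> by (auto simp: \<tau>_def divide_simps)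
    have "\<tau> \<longlonglongrightarrow> a - 0"
      unfolding \<tau>_def by (intro tendsto_intros LIMSEQ_Suc[OF lim_const_over_n])
    then have \<tau>lim: "\<tau> \<longlonglongrightarrow> a" by simp
    have "\<forall>n. \<exists>x. (\<tau> n, x) \<in> G" using below \<tau> by blast
    then obtain X where X: "\<And>n. (\<tau> n, X n) \<in> G" by metis
    have lip: "dist (X m) (X n) \<le> L * dist (\<tau> m) (\<tau> n)" for m n
    proof (cases "\<tau> m \<le> \<tau> n")
      case True
      then show ?thesis using step[OF X X True]
        by (auto simp: euler_step_def dist_norm norm_minus_commute)
    next
      case False
      then show ?thesis using step[OF X X, of n m]
        by (auto simp: euler_step_def dist_norm norm_minus_commute)
    qed
    have "Cauchy X"
    proof (rule metric_CauchyI)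
      fix e :: real assume "0 < e"
      then obtain N where "\<forall>m\<ge>N. \<forall>n\<ge>N. dist (\<tau> m) (\<tau> n) < e / L"
        using metric_CauchyD[OF LIMSEQ_imp_Cauchy[OF \<tau>lim], of "e / L"] L_pos by auto
      then have "\<forall>m\<ge>N. \<forall>n\<ge>N. L * dist (\<tau> m) (\<tau> n) < e"
        using L_pos by (simp add: field_simps)
      then show "\<exists>N. \<forall>m\<ge>N. \<forall>n\<ge>N. dist (X m) (X n) < e"
        using lip by (meson le_less_trans)
    qed
    then obtain y where y: "X \<longlonglongrightarrow> y" using Cauchy_convergent_iff convergent_def by blast
    have "y \<in> K" using closed_sequentially[OF closed _ y] X inG by blast
    have new: "euler_step \<epsilon> s x a y" if sx: "(s, x) \<in> G" for s x
    proof -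
      have "s < a" using le_a[OF sx] no sx by (cases "s = a") auto
      then obtain N where N: "\<And>n. n \<ge> N \<Longrightarrow> s < \<tau> n"
        using order_tendstoD(1)[OF \<tau>lim] by (auto simp: eventually_sequentially)
      show ?thesis
      proof (rule euler_step_limit[of \<epsilon> s x "\<lambda>n. \<tau> (n + N)" "\<lambda>n. X (n + N)"])
        show "euler_step \<epsilon> s x (\<tau> (n + N)) (X (n + N))" for n
          using step[OF sx X] N[of "n + N"] by simp
        show "s \<le> \<tau> (n + N)" "\<tau> (n + N) \<le> a" for n
          using N[of "n + N"] \<tau>(2)[of "n + N"] by auto
      qed (use LIMSEQ_ignore_initial_segment \<tau>lim y in blast)+
    qed
    have "euler_step \<epsilon> s x t z" if "(s, x) \<in> insert (a, y) G" "(t, z) \<in> insert (a, y) G" "s \<le> t" for s x t z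
    proof -
      have "euler_step \<epsilon> a y a y" by (simp add: euler_step_def)
      moreover have "(s, x) \<in> G \<or> t = a \<and> z = y" using that le_a no by fastforce
      ultimately show ?thesis using that step new by blast
    qed
    moreover have "insert (a, y) G \<subseteq> {0..T} \<times> K" "(0, x\<^sub>0) \<in> insert (a, y) G"
      using start inG a \<open>y \<in> K\<close> by auto
    moreover have "\<exists>x. (s, x) \<in> insert (a, y) G" if "(t, z) \<in> insert (a, y) G" "0 \<le> s" "s \<le> t" for s t z
      using below[of s] down[of t z s] that by (cases "s = a") force+
    ultimately have "euler_graph \<epsilon> T x\<^sub>0 (insert (a, y) G)"
      unfolding euler_graph_def by blast
    then have "insert (a, y) G = G" by (rule max) blast
    then show False using no by blast
  qed
  then obtain y where y: "(a, y) \<in> G" by blast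
  have "y \<in> K" using y inG by blast
  have "a = T"
  proof (rule ccontr)
    assume "a \<noteq> T"
    then have "a < T" using a by simp
    obtain \<xi> where \<xi>: "0 < \<xi>" "\<And>h. 0 < h \<Longrightarrow> h < \<xi> \<Longrightarrow> y + h *\<^sub>R Q y \<in> K"
      using inward[OF \<open>y \<in> K\<close>] by blast
    obtain d where d: "0 < d" "\<And>h. 0 \<le> h \<Longrightarrow> h \<le> d \<Longrightarrow> \<omega> (L * h) \<le> \<epsilon>"
      using modulus_small_time[OF assms(3)] by blast
    define h where "h = min (\<xi> / 2) (min d (T - a))"
    have h: "0 < h" "h < \<xi>" "h \<le> d" "a + h \<le> T" using \<xi> d \<open>a < T\<close> by (auto simp: h_def)
    \<comment> \<open>the new segment starts after \<open>a\<close>, so that it shares no time with \<open>G\<close>\<close>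
    define N where "N = (\<lambda>\<tau>. (a + \<tau>, y + \<tau> *\<^sub>R Q y)) ` {0<..h}"
    have N: "\<exists>\<tau>. 0 < \<tau> \<and> \<tau> \<le> h \<and> t = a + \<tau> \<and> z = y + \<tau> *\<^sub>R Q y \<and> z \<in> K" if "(t, z) \<in> N" for t z
      using that \<xi> h by (auto simp: N_def)
    have "euler_step \<epsilon> s x t z" if sx: "(s, x) \<in> G \<union> N" and tz: "(t, z) \<in> G \<union> N" and st: "s \<le> t" for s x t z
    proof (cases "(t, z) \<in> G")
      case True
      have "(s, x) \<in> G" using sx N[of s x] le_a[OF True] st by force
      then show ?thesis using step True st by blast
    next
      case False
      then obtain \<tau> where \<tau>: "0 < \<tau>" "\<tau> \<le> h" "t = a + \<tau>" "z = y + \<tau> *\<^sub>R Q y" using tz N by blast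
      show ?thesis
      proof (cases "(s, x) \<in> G")
        case True
        show ?thesis unfolding \<tau>(3,4)
          by (rule euler_step_prolong[OF step[OF True y]])
             (use True le_a inG \<open>y \<in> K\<close> \<tau> assms in auto)
      next
        case False
        then obtain \<sigma> where \<sigma>: "0 < \<sigma>" "\<sigma> \<le> h" "s = a + \<sigma>" "x = y + \<sigma> *\<^sub>R Q y" "x \<in> K"
          using sx N by blast
        show ?thesis unfolding \<tau>(3,4) \<sigma>(3,4)
          by (rule euler_step_segment) (use \<sigma> \<tau> st d h \<open>y \<in> K\<close> in auto)
      qed
    qed
    moreover have "G \<union> N \<subseteq> {0..T} \<times> K"
    proof (rule subrelI)
      fix t z assume "(t, z) \<in> G \<union> N"
      then show "(t, z) \<in> {0..T} \<times> K" using inG[of t z] N[of t z] h a by auto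
    qed
    moreover have "\<exists>x. (s, x) \<in> G \<union> N" if tz: "(t, z) \<in> G \<union> N" and s: "0 \<le> s" "s \<le> t" for s t z
    proof (cases "s \<le> a")
      case True
      then show ?thesis using down[OF y] s by blast
    next
      case False
      then have "t \<le> a + h" using tz N[of t z] le_a[of t z] s by force
      then have "(s, y + (s - a) *\<^sub>R Q y) \<in> N"
        unfolding N_def using False s by (intro image_eqI[of _ _ "s - a"]) auto
      then show ?thesis by blast
    qed
    ultimately have "euler_graph \<epsilon> T x\<^sub>0 (G \<union> N)"
      using start unfolding euler_graph_def by blast
    then have "G \<union> N = G" by (rule max) blast
    moreover have "(a + h, y + h *\<^sub>R Q y) \<in> N"
      unfolding N_def using h by (intro image_eqI[of _ _ h]) auto
    ultimately show False using le_a h by fastforce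
  qed
  then have "\<forall>t. \<exists>x. t \<in> {0..T} \<longrightarrow> (t, x) \<in> G" using down[OF y] by auto
  then obtain w where w: "\<And>t. t \<in> {0..T} \<Longrightarrow> (t, w t) \<in> G" by metis
  have "w 0 = x\<^sub>0"
    using step[OF start w[of 0]] assms by (simp add: euler_step_def)
  moreover have "\<forall>t\<in>{0..T}. w t \<in> K" using w inG(3) by blast
  moreover have "euler_step \<epsilon> s (w s) t (w t)" if "0 \<le> s" "s \<le> t" "t \<le> T" for s t
    using step[OF w w] that by simp
  ultimately show ?thesis by blast
qed

lemma euler_curve_continuous:
  assumes "\<And>s t. 0 \<le> s \<Longrightarrow> s \<le> t \<Longrightarrow> t \<le> T \<Longrightarrow> euler_step \<epsilon> s (w s) t (w t)"
  shows "continuous_on {0..T} w"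
proof (rule lipschitz_on_continuous_on[of L])
  have "dist (w s) (w t) \<le> L * dist s t" if "s \<in> {0..T}" "t \<in> {0..T}" "s \<le> t" for s t
    using assms[of s t] that by (simp add: euler_step_def dist_norm norm_minus_commute)
  then show "lipschitz_on L {0..T} w"
    using L_pos by (intro lipschitz_onI) (metis dist_commute linear, simp)
qed

text \<open>
  In \<open>euler_step\<close> the field is evaluated at the earlier point; evaluating it at the later point costs
  another \<open>\<omega> (L * (t - s))\<close>.
\<close>

lemma euler_curve_left_estimate:
  assumes "\<And>s t. 0 \<le> s \<Longrightarrow> s \<le> t \<Longrightarrow> t \<le> T \<Longrightarrow> euler_step \<epsilon> s (w s) t (w t)"
    and "\<And>t. t \<in> {0..T} \<Longrightarrow> w t \<in> K" and "0 \<le> s" "s \<le> t" "t \<le> T"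
  shows "norm (w t - w s - (t - s) *\<^sub>R Q (w t)) \<le> (t - s) * (\<epsilon> + 2 * \<omega> (L * (t - s)))"
proof -
  have st: "euler_step \<epsilon> s (w s) t (w t)" using assms by blast
  have "w t - w s - (t - s) *\<^sub>R Q (w t) = (w t - w s - (t - s) *\<^sub>R Q (w s)) - (t - s) *\<^sub>R (Q (w t) - Q (w s))"
    by (simp add: algebra_simps)
  then have "norm (w t - w s - (t - s) *\<^sub>R Q (w t))
      \<le> norm (w t - w s - (t - s) *\<^sub>R Q (w s)) + norm ((t - s) *\<^sub>R (Q (w t) - Q (w s)))"
    by (metis norm_triangle_ineq4)
  also have "\<dots> \<le> (t - s) * (\<epsilon> + \<omega> (L * (t - s))) + (t - s) * \<omega> (L * (t - s))"
    using st assms modulus_le[of "w t" "w s" "L * (t - s)"]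
    by (auto simp: euler_step_def intro!: add_mono mult_left_mono)
  finally show ?thesis by (simp add: algebra_simps)
qed

lemma euler_curve_left_defect:
  assumes "\<And>s t. 0 \<le> s \<Longrightarrow> s \<le> t \<Longrightarrow> t \<le> T \<Longrightarrow> euler_step \<epsilon> s (w s) t (w t)"
    and "\<And>t. t \<in> {0..T} \<Longrightarrow> w t \<in> K" and "0 < t" "t \<le> T"
  shows "left_defect Q \<epsilon> w t"
  unfolding left_defect_def
proof (intro allI impI)
  fix \<eta> :: real assume "0 < \<eta>"
  then obtain d where d: "0 < d" "\<And>h. 0 \<le> h \<Longrightarrow> h \<le> d \<Longrightarrow> \<omega> (L * h) \<le> \<eta> / 2"
    using modulus_small_time[of "\<eta> / 2"] by auto
  have "norm (w t - w (t - h) - h *\<^sub>R Q (w t)) \<le> h * (\<epsilon> + \<eta>)" if h: "0 < h" "h < min d t" for h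
  proof -
    have "norm (w t - w (t - h) - h *\<^sub>R Q (w t)) \<le> h * (\<epsilon> + 2 * \<omega> (L * h))"
      using euler_curve_left_estimate[of T \<epsilon> w "t - h" t] assms h by simp
    also have "\<dots> \<le> h * (\<epsilon> + \<eta>)" using h d(2)[of h] by (intro mult_left_mono) auto
    finally show ?thesis .
  qed
  then show "\<forall>\<^sub>F h in at_right 0. norm (w t - w (t - h) - h *\<^sub>R Q (w t)) \<le> h * (\<epsilon> + \<eta>)"
    using d(1) assms(3) by (auto simp: eventually_at_right_field intro!: exI[of _ "min d t"])
qed

lemma euler_curve_has_derivative:
  assumes w: "\<And>s t. 0 \<le> s \<Longrightarrow> s \<le> t \<Longrightarrow> t \<le> T \<Longrightarrow> euler_step 0 s (w s) t (w t)"
    and K: "\<And>t. t \<in> {0..T} \<Longrightarrow> w t \<in> K" and t: "t \<in> {0..T}"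
  shows "(w has_vector_derivative Q (w t)) (at t within {0..T})"
  unfolding has_vector_derivative_def has_derivative_within_alt
proof (intro conjI allI impI bounded_linear_scaleR_left)
  fix e :: real assume "0 < e"
  then obtain d where d: "0 < d" "\<And>h. 0 \<le> h \<Longrightarrow> h \<le> d \<Longrightarrow> \<omega> (L * h) \<le> e / 2"
    using modulus_small_time[of "e / 2"] by auto
  have "norm (w s - w t - (s - t) *\<^sub>R Q (w t)) \<le> e * norm (s - t)"
    if s: "s \<in> {0..T}" "norm (s - t) < d" for s
  proof (cases "s \<le> t")
    case True
    have "norm (w s - w t - (s - t) *\<^sub>R Q (w t)) = norm (- (w t - w s - (t - s) *\<^sub>R Q (w t)))"
      by (simp add: algebra_simps)
    also have "\<dots> = norm (w t - w s - (t - s) *\<^sub>R Q (w t))" by (rule norm_minus_cancel)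
    also have "\<dots> \<le> (t - s) * (0 + 2 * \<omega> (L * (t - s)))"
      using True s t by (intro euler_curve_left_estimate[OF w K]) auto
    also have "\<dots> \<le> (t - s) * e" using True d(2)[of "t - s"] s by (intro mult_left_mono) auto
    finally show ?thesis using True by (simp add: mult.commute)
  next
    case False
    have "norm (w s - w t - (s - t) *\<^sub>R Q (w t)) \<le> (s - t) * (0 + \<omega> (L * (s - t)))"
      using w[of t s] False s t by (simp add: euler_step_def)
    also have "\<dots> \<le> (s - t) * e"
      using False d(2)[of "s - t"] s \<open>0 < e\<close> by (intro mult_left_mono) auto
    finally show ?thesis using False by (simp add: mult.commute)
  qed
  then show "\<exists>d>0. \<forall>y\<in>{0..T}. norm (y - t) < d \<longrightarrow>
      norm (w y - w t - (y - t) *\<^sub>R Q (w t)) \<le> e * norm (y - t)" using d by blast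
qed

section \<open>Existence\<close>

text \<open>
  Euler curves with defects \<open>\<epsilon> n\<close> tending to 0 form a Cauchy sequence at each time by
  \<open>left_defect_comparison\<close>. Pointwise convergence is enough: the relation \<open>euler_step\<close> between two given
  times passes to the limit, where it holds with \<open>\<epsilon> = 0\<close>, and this already contains
  differentiability.
\<close>

lemma solution_exists:
  assumes osl: "\<And>u v. u \<in> K \<Longrightarrow> v \<in> K \<Longrightarrow> bracket (Q u - Q v) (u - v) \<le> A * norm (u - v)"
    and A: "0 \<le> A" and "x\<^sub>0 \<in> K" "0 \<le> T"
  shows "\<exists>u. u 0 = x\<^sub>0 \<and> (\<forall>t\<in>{0..T}. u t \<in> K \<and> (u has_vector_derivative Q (u t)) (at t within {0..T}))"
proof -
  define \<epsilon> where "\<epsilon> n = inverse (real (Suc n))" for n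
  have \<epsilon>: "0 < \<epsilon> n" for n by (simp add: \<epsilon>_def)
  have \<epsilon>0: "\<epsilon> \<longlonglongrightarrow> 0" unfolding \<epsilon>_def by (rule LIMSEQ_inverse_real_of_nat)
  have "\<forall>n. \<exists>w. w 0 = x\<^sub>0 \<and> (\<forall>t\<in>{0..T}. w t \<in> K) \<and>
    (\<forall>s t. 0 \<le> s \<longrightarrow> s \<le> t \<longrightarrow> t \<le> T \<longrightarrow> euler_step (\<epsilon> n) s (w s) t (w t))"
    using euler_curve_exists[OF assms(3,4) \<epsilon>] by blast
  then obtain w where w0: "\<And>n. w n 0 = x\<^sub>0" and wK: "\<And>n t. t \<in> {0..T} \<Longrightarrow> w n t \<in> K"
    and wE: "\<And>n s t. 0 \<le> s \<Longrightarrow> s \<le> t \<Longrightarrow> t \<le> T \<Longrightarrow> euler_step (\<epsilon> n) s (w n s) t (w n t)"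
    by metis
  have wc: "continuous_on {0..T} (w n)" for n by (rule euler_curve_continuous[OF wE])
  have wd: "left_defect Q (\<epsilon> n) (w n) t" if "0 < t" "t \<le> T" for n t
    by (rule euler_curve_left_defect[OF wE wK that])
  have close: "norm (w m t - w n t) \<le> (\<epsilon> m + \<epsilon> n) * exp ((A + 1) * t)" if "t \<in> {0..T}" for m n t
    by (rule left_defect_comparison[where K = K and Q = Q and b = T])
       (use assms w0 wK wc wd that less_imp_le[OF \<epsilon>] in auto)
  have "\<exists>y. (\<lambda>n. w n t) \<longlonglongrightarrow> y" if t: "t \<in> {0..T}" for t
  proof -
    have "Cauchy (\<lambda>n. w n t)"
    proof (rule metric_CauchyI)
      fix e :: real assume "0 < e"
      have "(\<lambda>n. \<epsilon> n * exp ((A + 1) * t)) \<longlonglongrightarrow> 0 * exp ((A + 1) * t)"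
        by (intro tendsto_intros \<epsilon>0)
      then have "\<forall>\<^sub>F n in sequentially. \<epsilon> n * exp ((A + 1) * t) < e / 2"
        by (rule order_tendstoD) (use \<open>0 < e\<close> in simp)
      then obtain N where N: "\<And>n. n \<ge> N \<Longrightarrow> \<epsilon> n * exp ((A + 1) * t) < e / 2"
        by (auto simp: eventually_sequentially)
      have "dist (w m t) (w n t) < e" if "m \<ge> N" "n \<ge> N" for m n
        using close[OF t, of m n] N[OF that(1)] N[OF that(2)]
        by (simp add: dist_norm distrib_right)
      then show "\<exists>N. \<forall>m\<ge>N. \<forall>n\<ge>N. dist (w m t) (w n t) < e" by blast
    qed
    then show ?thesis using Cauchy_convergent_iff convergent_def by blast
  qed
  then have "\<forall>t. \<exists>y. t \<in> {0..T} \<longrightarrow> (\<lambda>n. w n t) \<longlonglongrightarrow> y" by blast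
  then obtain u where u: "\<And>t. t \<in> {0..T} \<Longrightarrow> (\<lambda>n. w n t) \<longlonglongrightarrow> u t" by metis
  have uK: "u t \<in> K" if "t \<in> {0..T}" for t
    using closed_sequentially[OF closed _ u[OF that]] wK[OF that] by blast
  have Qu: "(\<lambda>n. Q (w n t)) \<longlonglongrightarrow> Q (u t)" if "t \<in> {0..T}" for t
    using continuous_on_tendsto_compose[OF continuous_on_field u[OF that] uK[OF that]] wK[OF that]
    by simp
  have uE: "euler_step 0 s (u s) t (u t)" if st: "0 \<le> s" "s \<le> t" "t \<le> T" for s t
    unfolding euler_step_def
  proof
    have ust: "(\<lambda>n. w n s) \<longlonglongrightarrow> u s" "(\<lambda>n. w n t) \<longlonglongrightarrow> u t" "(\<lambda>n. Q (w n s)) \<longlonglongrightarrow> Q (u s)"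
      using u Qu st by auto
    show "norm (u t - u s) \<le> L * (t - s)"
    proof (rule LIMSEQ_le_const2)
      show "(\<lambda>n. norm (w n t - w n s)) \<longlonglongrightarrow> norm (u t - u s)" by (intro tendsto_intros ust)
    qed (use wE[OF st] in \<open>auto simp: euler_step_def\<close>)
    show "norm (u t - u s - (t - s) *\<^sub>R Q (u s)) \<le> (t - s) * (0 + \<omega> (L * (t - s)))"
    proof (rule LIMSEQ_le)
      show "(\<lambda>n. norm (w n t - w n s - (t - s) *\<^sub>R Q (w n s))) \<longlonglongrightarrow> norm (u t - u s - (t - s) *\<^sub>R Q (u s))"
        by (intro tendsto_intros ust)
      show "(\<lambda>n. (t - s) * (\<epsilon> n + \<omega> (L * (t - s)))) \<longlonglongrightarrow> (t - s) * (0 + \<omega> (L * (t - s)))"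
        by (intro tendsto_intros \<epsilon>0)
    qed (use wE[OF st] in \<open>auto simp: euler_step_def\<close>)
  qed
  have "u 0 = x\<^sub>0" using LIMSEQ_unique[OF u[of 0]] w0 assms(4) by simp
  then show ?thesis using uK euler_curve_has_derivative[OF uE uK] by blast
qed

end

section \<open>The sub-tangent condition and the norm of the subspace\<close>

lemma subtangent_mem_closed:
  assumes "closed K" and near: "\<forall>\<^sub>F \<delta> in at_right 0. \<exists>z \<in> (ball y \<delta> \<inter> K) - {y}. P z"
  shows "y \<in> K"
proof -
  have "\<exists>z\<in>K. dist z y < e" if "0 < e" for e
  proof -
    have "\<forall>\<^sub>F \<delta> in at_right (0::real). \<delta> < e"
      using that eventually_at_right_real[of 0 e] by (auto elim: eventually_mono)
    with near have "\<forall>\<^sub>F \<delta> in at_right (0::real). \<exists>z\<in>K. dist z y < e"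
      by eventually_elim (force simp: dist_commute)
    then show ?thesis by simp
  qed
  then show ?thesis using \<open>closed K\<close> closure_approachable closure_closed by metis
qed

lemma inward_if_subtangent:
  assumes "closed K"
    and "\<exists>\<xi>>0. \<forall>h. 0 < h \<and> h < \<xi> \<longrightarrow>
      (\<forall>\<^sub>F \<delta> in at_right 0. \<exists>z \<in> (ball (x + h *\<^sub>R v) \<delta> \<inter> K) - {x + h *\<^sub>R v}. P h z)"
  shows "\<exists>\<xi>>0. \<forall>h. 0 < h \<and> h < \<xi> \<longrightarrow> x + h *\<^sub>R v \<in> K"
proof -
  obtain \<xi> where \<xi>: "0 < \<xi>" "\<And>h. 0 < h \<and> h < \<xi> \<Longrightarrow>
      \<forall>\<^sub>F \<delta> in at_right 0. \<exists>z \<in> (ball (x + h *\<^sub>R v) \<delta> \<inter> K) - {x + h *\<^sub>R v}. P h z"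
    using assms(2) by blast
  have "x + h *\<^sub>R v \<in> K" if "0 < h \<and> h < \<xi>" for h
    using subtangent_mem_closed[OF \<open>closed K\<close> \<xi>(2)[OF that]] .
  then show ?thesis using \<xi>(1) by blast
qed

lemma banach_subspace_metric:
  assumes "banach_subspace F nF"
  shows "Metric_space F (sub_dist F nF)"
proof
  have sub: "subspace F" using assms by (simp add: banach_subspace_def)
  note diff = subspace_diff[OF sub]
  have nonneg: "0 \<le> nF u" and zero: "nF u = 0 \<longleftrightarrow> u = 0"
    and scale: "nF (c *\<^sub>R u) = \<bar>c\<bar> * nF u" if "u \<in> F" for u c
    using assms that by (simp_all add: banach_subspace_def)
  have tri: "nF (u + v) \<le> nF u + nF v" if "u \<in> F" "v \<in> F" for u v
    using assms that by (simp add: banach_subspace_def)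
  show "0 \<le> sub_dist F nF x y" for x y
    using nonneg diff by (simp add: sub_dist_def)
  show "sub_dist F nF x y = sub_dist F nF y x" for x y
    using scale[OF diff, of y x "-1"] by (simp add: sub_dist_def)
  show "sub_dist F nF x y = 0 \<longleftrightarrow> x = y" if "x \<in> F" "y \<in> F" for x y
    using zero[OF diff[OF that]] that by (simp add: sub_dist_def)
  show "sub_dist F nF x z \<le> sub_dist F nF x y + sub_dist F nF y z"
    if "x \<in> F" "y \<in> F" "z \<in> F" for x y z
    using tri[OF diff[OF that(1,2)] diff[OF that(2,3)]] that by (simp add: sub_dist_def)
qed

lemma mbounded_sub_norm:
  assumes F: "banach_subspace F nF" and K: "Metric_space.mbounded F (sub_dist F nF) K"
  shows "\<exists>B. \<forall>x\<in>K. nF x \<le> B"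
proof (cases "K = {}")
  case False
  interpret Metric_space F "sub_dist F nF" by (rule banach_subspace_metric[OF F])
  have sub: "subspace F" using F by (simp add: banach_subspace_def)
  have tri: "nF (u + v) \<le> nF u + nF v" if "u \<in> F" "v \<in> F" for u v
    using F that by (simp add: banach_subspace_def)
  obtain y B where yB: "y \<in> F" "\<And>x. x \<in> K \<Longrightarrow> x \<in> F" "\<And>x. x \<in> K \<Longrightarrow> sub_dist F nF y x \<le> B"
    using K False unfolding mbounded by blast
  have "nF x \<le> B + nF y" if "x \<in> K" for x
  proof -
    have x: "x \<in> F" using yB that by blast
    have "nF ((x - y) + y) \<le> nF (x - y) + nF y"
      by (rule tri[OF subspace_diff[OF sub x yB(1)] yB(1)])
    moreover have "nF (x - y) = sub_dist F nF y x"
      using x yB(1) commute[of x y] by (simp add: sub_dist_def)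
    ultimately show ?thesis using yB(3)[OF that] by simp
  qed
  then show ?thesis by blast
qed simp

theorem theorem1p2:
  fixes M :: "(real ^ 'd) measure"
    and val :: "'e::banach \<Rightarrow> real ^ 'd \<Rightarrow> real"
    and F :: "'e set"
    and nF sF :: "'e \<Rightarrow> real"
    and T :: real
    and S :: "real \<Rightarrow> 'e set"
    and R_sub R_sup R\<^sub>0 C_sub C_sup :: real
    and Q :: "'e \<Rightarrow> 'e"
    and u\<^sub>0 :: 'e
  assumes E: "function_space M val"
    and F: "banach_subspace F nF"
    and norm_le: "\<And>u. u \<in> F \<Longrightarrow> norm u \<le> nF u"
    and sF_le: "\<And>u. u \<in> F \<Longrightarrow> sF u \<le> nF u"
    and sF_add: "\<And>u v. u \<in> F \<Longrightarrow> v \<in> F \<Longrightarrow> sF (u + v) \<le> sF u + sF v"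
    and sF_scale: "\<And>u c. u \<in> F \<Longrightarrow> 0 \<le> c \<Longrightarrow> sF (c *\<^sub>R u) = c * sF u"
    and T: "0 < T"
    and S_bounded: "\<And>t. t \<in> {0..T} \<Longrightarrow> Metric_space.mbounded F (sub_dist F nF) (S t)"
    and S_closed: "\<And>t. t \<in> {0..T} \<Longrightarrow> closedin (sub_topology F nF) (S t)"
    and S_nonneg: "\<And>t u. t \<in> {0..T} \<Longrightarrow> u \<in> S t \<Longrightarrow> nonneg_fun M val u"
    and S_mono: "\<And>t t'. 0 \<le> t \<Longrightarrow> t \<le> t' \<Longrightarrow> t' \<le> T \<Longrightarrow> S t \<subseteq> S t'"
    and S_sF: "\<And>u. u \<in> S T \<Longrightarrow> sF u = nF u"
    and S_conv: "\<And>X u C. (\<And>n::nat. X n \<in> S T) \<Longrightarrow> (\<And>n. nonneg_fun M val (X n)) \<Longrightarrow>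
           (\<And>n. nF (X n) \<le> C) \<Longrightarrow> (\<lambda>n. norm (X n - u)) \<longlonglongrightarrow> 0 \<Longrightarrow>
           u \<in> F \<and> (\<lambda>n. nF (X n - u)) \<longlonglongrightarrow> 0"
    and R: "0 < R_sup" "R_sup < R_sub"
    and pos: "0 < R\<^sub>0" "0 < C_sub" "0 < C_sup"
    and hoelder: "\<exists>C>0. \<exists>\<beta>. 0 < \<beta> \<and> \<beta> < 1 \<and>
           (\<forall>u\<in>S T. \<forall>v\<in>S T. norm (Q u - Q v) \<le> C * norm (u - v) powr \<beta>)"
    and sub_tangent: "\<forall>u\<in>S T. \<exists>\<xi>\<^sub>u>0. \<forall>\<xi>. 0 < \<xi> \<and> \<xi> < \<xi>\<^sub>u \<longrightarrow>
           (\<forall>\<^sub>F \<delta> in at_right 0. \<exists>z \<in> (ball (u + \<xi> *\<^sub>R Q u) \<delta> \<inter> S T) - {u + \<xi> *\<^sub>R Q u}.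
              sF (z - u) \<le> C_sub * \<xi> / 2 * nF u \<and>
              (AE x in M. indicator (ball 0 R\<^sub>0) x * (val (z - u) x / \<xi>)
                            \<ge> - (C_sup * indicator (ball 0 R\<^sub>0) x / 2 * val u x)))"
    and one_sided_lipschitz: "\<exists>C>0. \<forall>u\<in>S T. \<forall>v\<in>S T.
           bracket (Q u - Q v) (u - v) \<le> C * norm (u - v)"
    and S_lower: "S T \<inter> ball 0 (R_sup * exp (- C_sup * T) / 2) = {}"
    and S_upper: "S T \<subseteq> ball 0 ((2 * R_sub + 1) * exp (C_sub * T))"
    and u\<^sub>0: "u\<^sub>0 \<in> (S 0 \<inter> sub_ball F nF 0 R_sub)
                 - (sub_topology F nF closure_of sub_ball F nF 0 R_sup)"
  shows "\<exists>u. evolution_solution F nF (S T) Q T u\<^sub>0 u \<and>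
           (\<forall>v. evolution_solution F nF (S T) Q T u\<^sub>0 v \<longrightarrow> (\<forall>t\<in>{0..<T}. v t = u t))"
proof -
  define K where "K = S T"
  have TT: "T \<in> {0..T}" using T by simp
  interpret F: Metric_space F "sub_dist F nF" by (rule banach_subspace_metric[OF F])
  have Kclosed: "closedin F.mtopology K" unfolding K_def by (rule S_closed[OF TT])
  then have KF: "K \<subseteq> F" using closedin_subset by fastforce
  \<comment> \<open>this uniform \<open>nF\<close>-bound is what makes the convergence property applicable to every sequence in \<open>K\<close>\<close>
  obtain B where B: "\<And>x. x \<in> K \<Longrightarrow> nF x \<le> B"
    using mbounded_sub_norm[OF F S_bounded[OF TT]] unfolding K_def by blast
  have conv: "u \<in> F" "(\<lambda>n. nF (X n - u)) \<longlonglongrightarrow> 0"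
    if "\<And>n::nat. X n \<in> K" "(\<lambda>n. norm (X n - u)) \<longlonglongrightarrow> 0" for X u
    using S_conv[of X B u] S_nonneg[OF TT] B that unfolding K_def by blast+
  have "closed K"
    unfolding closed_sequential_limits
  proof (intro allI impI)
    fix X u assume X: "(\<forall>n. X n \<in> K) \<and> X \<longlonglongrightarrow> u"
    then have n0: "(\<lambda>n. norm (X n - u)) \<longlonglongrightarrow> 0" by (simp add: LIM_zero tendsto_norm_zero)
    have u: "u \<in> F" and l: "(\<lambda>n. nF (X n - u)) \<longlonglongrightarrow> 0" using conv[OF _ n0] X by blast+
    have XF: "X n \<in> F" for n using X KF by blast
    have "limitin F.mtopology X u sequentially"
      unfolding F.limitin_metric_dist_null using u XF l by (simp add: sub_dist_def)
    moreover have "range X \<subseteq> K" using X by blast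
    ultimately show "u \<in> K"
      using Kclosed unfolding F.metric_closedin_iff_sequentially_closed by blast
  qed
  have u0K: "u\<^sub>0 \<in> K" using u\<^sub>0 S_mono[of 0 T] T unfolding K_def by auto
  obtain C \<beta> where C: "0 < C" and \<beta>: "0 < \<beta>"
    and hold: "\<And>u v. u \<in> K \<Longrightarrow> v \<in> K \<Longrightarrow> norm (Q u - Q v) \<le> C * norm (u - v) powr \<beta>"
    using hoelder unfolding K_def by blast
  obtain A where A: "0 < A"
    and osl: "\<And>u v. u \<in> K \<Longrightarrow> v \<in> K \<Longrightarrow> bracket (Q u - Q v) (u - v) \<le> A * norm (u - v)"
    using one_sided_lipschitz unfolding K_def by blast
  have KB: "norm u \<le> B" if "u \<in> K" for u
    using norm_le[of u] B[OF that] KF that by fastforce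
  \<comment> \<open>\<open>K\<close> has diameter at most \<open>B + B\<close>, so Hoelder continuity bounds the field; adding 1 makes \<open>L\<close> positive\<close>
  define L where "L = norm (Q u\<^sub>0) + C * (B + B) powr \<beta> + 1"
  interpret inward_field K Q L "\<lambda>r. C * r powr \<beta>"
  proof
    show "closed K" by fact
    show "0 < L" using C by (simp add: L_def add_nonneg_pos)
    show "norm (Q x - Q y) \<le> C * norm (x - y) powr \<beta>" if "x \<in> K" "y \<in> K" for x y
      using hold that by blast
    show "C * r powr \<beta> \<le> C * s powr \<beta>" if "0 \<le> r" "r \<le> s" for r s
      using that C \<beta> by (intro mult_left_mono powr_mono2) auto
    \<comment> \<open>the \<open>d\<close> with \<open>C * d powr \<beta> = e\<close>\<close>
    show "\<exists>d>0. C * d powr \<beta> \<le> e" if "0 < e" for e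
      using that C \<beta> by (intro exI[of _ "(e / C) powr (1 / \<beta>)"]) (simp add: powr_powr)
    show "norm (Q x) \<le> L" if x: "x \<in> K" for x
    proof -
      have "norm (x - u\<^sub>0) \<le> B + B"
        using norm_triangle_ineq4[of x "u\<^sub>0"] KB[OF x] KB[OF u0K] by linarith
      then have "C * norm (x - u\<^sub>0) powr \<beta> \<le> C * (B + B) powr \<beta>"
        using C \<beta> by (intro mult_left_mono powr_mono2) auto
      then show ?thesis
        using hold[OF x u0K] norm_triangle_sub[of "Q x" "Q u\<^sub>0"] unfolding L_def by linarith
    qed
    show "\<exists>\<xi>>0. \<forall>h. 0 < h \<and> h < \<xi> \<longrightarrow> x + h *\<^sub>R Q x \<in> K" if x: "x \<in> K" for x
      using bspec[OF sub_tangent x[unfolded K_def]] unfolding K_def[symmetric]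
      by (rule inward_if_subtangent[OF \<open>closed K\<close>])
  qed
  obtain u where u0: "u 0 = u\<^sub>0" and uK: "\<And>t. t \<in> {0..T} \<Longrightarrow> u t \<in> K"
    and uQ: "\<And>t. t \<in> {0..T} \<Longrightarrow> (u has_vector_derivative Q (u t)) (at t within {0..T})"
    using solution_exists[OF osl less_imp_le[OF A] u0K less_imp_le[OF T]] by blast
  have uc: "continuous_on {0..T} u"
    using uQ has_vector_derivative_continuous continuous_on_eq_continuous_within by blast
  have "evolution_solution F nF (S T) Q T u\<^sub>0 u"
    unfolding evolution_solution_def K_def[symmetric]
  proof (intro conjI ballI)
    have d: "(u has_vector_derivative Q (u t)) (at t)" if t: "t \<in> {0<..<T}" for t
    proof -
      have "(u has_vector_derivative Q (u t)) (at t within {0<..<T})"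
        by (rule has_vector_derivative_within_subset[OF uQ]) (use t in auto)
      then show ?thesis using at_within_open[OF t open_greaterThanLessThan] by simp
    qed
    have "continuous_on {0<..<T} (\<lambda>t. Q (u t))"
      by (rule continuous_on_compose2[OF continuous_on_field continuous_on_subset[OF uc]])
         (use uK in auto)
    then show "u C1_differentiable_on {0<..<T}"
      unfolding C1_differentiable_on_def by (intro exI[of _ "\<lambda>t. Q (u t)"] conjI ballI d)
    show "(u has_vector_derivative Q (u t)) (at t within {0..<T})" if "t \<in> {0..<T}" for t
      by (rule has_vector_derivative_within_subset[OF uQ]) (use that in auto)
    \<comment> \<open>along sequences of times, norm convergence of the solution improves to \<open>nF\<close>-convergence\<close>
    have strong: "(\<lambda>n. nF (u (X n) - u t)) \<longlonglongrightarrow> 0"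
      if "t \<in> {0..<T}" "\<And>n::nat. X n \<in> {0..<T}" "X \<longlonglongrightarrow> t" for X t
    proof (rule conv)
      show "u (X n) \<in> K" for n using uK[of "X n"] that(2)[of n] by simp
      have "(\<lambda>n. u (X n)) \<longlonglongrightarrow> u t"
        by (rule continuous_on_tendsto_compose[OF uc that(3)])
           (use that in \<open>auto simp: less_imp_le\<close>)
      then show "(\<lambda>n. norm (u (X n) - u t)) \<longlonglongrightarrow> 0" by (simp add: LIM_zero tendsto_norm_zero)
    qed
    have uF: "u t \<in> F" if "t \<in> {0..<T}" for t using uK[of t] KF that by auto
    have "continuous_map (top_of_set {0..<T}) F.mtopology u"
      unfolding F.continuous_map_to_metric
    proof (intro ballI allI impI)
      fix t e :: real assume "t \<in> topspace (top_of_set {0..<T})" and e: "0 < e"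
      then have t: "t \<in> {0..<T}" by simp
      have "\<exists>d>0. \<forall>s\<in>{0..<T}. dist s t < d \<longrightarrow> nF (u s - u t) < e"
      proof (rule ccontr)
        assume no: "\<not> ?thesis"
        have "\<forall>n. \<exists>s\<in>{0..<T}. dist s t < inverse (real (Suc n)) \<and> e \<le> nF (u s - u t)"
          using no by (metis inverse_positive_iff_positive not_less of_nat_0_less_iff zero_less_Suc)
        then obtain X where X: "\<And>n. X n \<in> {0..<T}" "\<And>n. dist (X n) t < inverse (real (Suc n))"
          "\<And>n. e \<le> nF (u (X n) - u t)" by metis
        have "(\<lambda>n. dist (X n) t) \<longlonglongrightarrow> 0"
          by (rule tendsto_sandwich[OF _ _ tendsto_const LIMSEQ_inverse_real_of_nat])
             (use less_imp_le[OF X(2)] in \<open>auto intro!: always_eventually\<close>)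
        then have "X \<longlonglongrightarrow> t" by (rule tendsto_dist_iff[THEN iffD2])
        from strong[OF t X(1) this] have "\<forall>\<^sub>F n in sequentially. nF (u (X n) - u t) < e"
          using e by (rule order_tendstoD)
        then show False using X(3) by (auto simp: eventually_sequentially not_less[symmetric])
      qed
      then obtain d where d: "0 < d" "\<And>s. s \<in> {0..<T} \<Longrightarrow> dist s t < d \<Longrightarrow> nF (u s - u t) < e"
        by blast
      have "openin (top_of_set {0..<T}) ({0..<T} \<inter> ball t d)" by (simp add: openin_open_Int)
      moreover have "u s \<in> F.mball (u t) e" if s: "s \<in> {0..<T} \<inter> ball t d" for s
      proof -
        have "nF (u s - u t) < e" using d(2)[of s] s by (simp add: dist_commute)
        then have "sub_dist F nF (u t) (u s) < e"
          using uF[of s] uF[OF t] s F.commute[of "u t" "u s"] by (simp add: sub_dist_def)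
        then show ?thesis using uF[of s] uF[OF t] s by simp
      qed
      ultimately show "\<exists>U. openin (top_of_set {0..<T}) U \<and> t \<in> U \<and> (\<forall>y\<in>U. u y \<in> F.mball (u t) e)"
        using t d(1) by (intro exI[of _ "{0..<T} \<inter> ball t d"]) auto
    qed
    then show "continuous_map (top_of_set {0..<T}) (subtopology F.mtopology K) u"
      using uK by (auto simp: continuous_map_in_subtopology)
  qed (rule u0)
  \<comment> \<open>a competitor is differentiable on \<open>[0,T)\<close> only, so the comparison is made on \<open>[0,t]\<close>\<close>
  moreover have "v t = u t" if v: "evolution_solution F nF (S T) Q T u\<^sub>0 v" and t: "t \<in> {0..<T}" for v t
  proof -
    have v0: "v 0 = u\<^sub>0"
      and vQ: "\<And>s. s \<in> {0..<T} \<Longrightarrow> (v has_vector_derivative Q (v s)) (at s within {0..<T})"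
      and vc: "continuous_map (top_of_set {0..<T}) (subtopology F.mtopology K) v"
      using v by (simp_all add: evolution_solution_def K_def)
    have vK: "v s \<in> K" if "s \<in> {0..<T}" for s
      using vc that by (auto simp: continuous_map_in_subtopology image_subset_iff)
    have sub: "{0..t} \<subseteq> {0..<T}" "{0..t} \<subseteq> {0..T}" using t by auto
    have vsol: "v s \<in> K \<and> (v has_vector_derivative Q (v s)) (at s within {0..t})" if "s \<in> {0..t}" for s
      by (intro conjI vK has_vector_derivative_within_subset[OF vQ sub(1)] subsetD[OF sub(1) that])
    have usol: "u s \<in> K \<and> (u has_vector_derivative Q (u s)) (at s within {0..t})" if "s \<in> {0..t}" for s
      by (intro conjI uK has_vector_derivative_within_subset[OF uQ sub(2)] subsetD[OF sub(2) that])
    show ?thesis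
    proof (rule solution_unique[where K = K and Q = Q and A = A and b = t and x = v and y = u])
      show "v 0 = u 0" using v0 u0 by simp
      show "t \<in> {0..t}" using t by simp
    qed (fact osl less_imp_le[OF A] vsol usol)+
  qed
  ultimately show ?thesis by blast
qed

end
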